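(* Let $S_c$ be a finite set of sample points as in the context. The optimal value of the problem $$\min_{x\in X}\; f(x)+\hat\phi(x|S_c)$$ is a lower bound for the optimal value of the problem $$\min_{x\in X}\; f(x)+\phi(x).$$
   Context: Setting. Let $x^l,x^u\in\mathbb{R}^n$ with $x^l_k\le x^u_k$, and $B=\{x\in\mathbb{R}^n: x^l_k\le x_k\le x^u_k,\ k=1,\dots,n\}$. Let $D\subseteq\mathbb{R}^n$ be a convex set with $B\subseteq D$ (the domain of $\phi$), let $\phi:D\to\mathbb{R}$ be strictly concave, and let $f,g_1,\dots,g_I:D\to\mathbb{R}$ be convex; all these functions are Lipschitz continuous (Euclidean norm). Let $J\subseteq\{1,\dots,n\}$ be an arbitrary (possibly empty) set of indices of variables required to be integer. The feasible set is $$X=\{x\in B:\ g_i(x)\le 0\ (i=1,\dots,I),\ x_k\in\mathbb{Z}\ (k\in J)\}.$$ Optimal values are $+\infty$ when $X=\emptyset$. Inner approximation. For a finite set of sample points $S_c=\{z^1,\dots,z^{\tau}\}\subset D$ with $D\subseteq\operatorname{conv}S_c$, define for $x\in\operatorname{conv} S_c$ $$\hat\phi(x|S_c)=\max_{\mu}\Big\{\sum_{j=1}^{\tau}\mu_j\phi(z^j):\ \sum_{j=1}^{\tau}\mu_j=1,\ \sum_{j=1}^{\tau}\mu_j z^j_k=x_k\ (k=1,\dots,n),\ \mu_j\ge 0\ (j=1,\dots,\tau)\Big\}.$$ *)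

theory Defs
  imports "HOL-Analysis.Analysis"
begin

definition strictly_concave_on :: "'a::real_vector set \<Rightarrow> ('a \<Rightarrow> real) \<Rightarrow> bool" where
  "strictly_concave_on D h \<longleftrightarrow> convex D \<and>
     (\<forall>x\<in>D. \<forall>y\<in>D. \<forall>u>0. \<forall>v>0. x \<noteq> y \<and> u + v = 1 \<longrightarrow>
        h (u *\<^sub>R x + v *\<^sub>R y) > u * h x + v * h y)"

(* On real ^ 'n, cbox xl xu is the set of x with xl $ k <= x $ k <= xu $ k for all k. *)
definition feasible_set ::
  "real ^ 'n \<Rightarrow> real ^ 'n \<Rightarrow> nat \<Rightarrow> (nat \<Rightarrow> real ^ 'n \<Rightarrow> real) \<Rightarrow> 'n set \<Rightarrow> (real ^ 'n) set" where
  "feasible_set xl xu I g J =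
     {x \<in> cbox xl xu. (\<forall>i\<in>{1..I}. g i x \<le> 0) \<and> (\<forall>k\<in>J. x $ k \<in> \<int>)}"

(* Weights are indexed by the sample points themselves. For finite S and x in the
   convex hull of S, the weights range over a nonempty compact set, so the maximum exists;
   for other x the value is unspecified. *)
definition inner_approx :: "(real ^ 'n \<Rightarrow> real) \<Rightarrow> (real ^ 'n) set \<Rightarrow> real ^ 'n \<Rightarrow> real" where
  "inner_approx \<phi> S x =
     (GREATEST v. \<exists>\<mu> :: real ^ 'n \<Rightarrow> real.
        v = (\<Sum>z\<in>S. \<mu> z * \<phi> z) \<and>
        (\<Sum>z\<in>S. \<mu> z) = 1 \<and>
        (\<forall>k. (\<Sum>z\<in>S. \<mu> z * z $ k) = x $ k) \<and>
        (\<forall>z\<in>S. \<mu> z \<ge> 0))"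

(* Extended-real valued, so that the value over the empty set is \<infinity>. *)
definition optimal_value :: "'a set \<Rightarrow> ('a \<Rightarrow> real) \<Rightarrow> ereal" where
  "optimal_value X h = (INF x\<in>X. ereal (h x))"

end

theory Submission
  imports Defs
begin

text \<open>The weighted averages of sample values over a point are the vertical slice, over that point,
  of the convex hull of the sampled graph. This hull is compact, so the maximum defining
  \<^const>\<open>inner_approx\<close> is attained, and Jensen's inequality bounds it by the concave function.\<close>

lemma slice_convex_hull_graph:
  fixes h :: "real ^ 'n \<Rightarrow> real"
  assumes "finite S"
  shows "(x, v) \<in> convex hull ((\<lambda>z. (z, h z)) ` S) \<longleftrightarrow>
    (\<exists>\<mu>. v = (\<Sum>z\<in>S. \<mu> z * h z) \<and> (\<Sum>z\<in>S. \<mu> z) = 1 \<and>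
      (\<forall>k. (\<Sum>z\<in>S. \<mu> z * z $ k) = x $ k) \<and> (\<forall>z\<in>S. \<mu> z \<ge> 0))"
    (is "?L \<longleftrightarrow> ?R")
proof -
  let ?p = "\<lambda>z. (z, h z)"
  \<comment> \<open>The first component of \<open>?p z\<close> recovers \<open>z\<close>, so
    distinct sample points give distinct graph points. Sums over the graph therefore reindex to sums
    over \<open>S\<close>, even where \<open>h\<close> repeats values.\<close>
  have inj: "inj_on ?p S"
    by (auto simp: inj_on_def)
  have sum_graph: "(\<Sum>z\<in>S. (u (?p z) *\<^sub>R z, u (?p z) * h z)) = (x, v) \<longleftrightarrow>
      v = (\<Sum>z\<in>S. u (?p z) * h z) \<and> (\<forall>k. (\<Sum>z\<in>S. u (?p z) * z $ k) = x $ k)" for u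
    by (auto simp: prod_eq_iff fst_sum snd_sum vec_eq_iff)
  have "?L \<longleftrightarrow> (\<exists>u. (\<forall>z\<in>S. 0 \<le> u (?p z)) \<and> (\<Sum>z\<in>S. u (?p z)) = 1 \<and>
      v = (\<Sum>z\<in>S. u (?p z) * h z) \<and> (\<forall>k. (\<Sum>z\<in>S. u (?p z) * z $ k) = x $ k))"
    using assms by (simp add: convex_hull_finite sum_graph sum.reindex[OF inj])
  also have "\<dots> \<longleftrightarrow> ?R"
  proof
    assume ?R
    then obtain \<mu> where "v = (\<Sum>z\<in>S. \<mu> z * h z) \<and> (\<Sum>z\<in>S. \<mu> z) = 1 \<and>
      (\<forall>k. (\<Sum>z\<in>S. \<mu> z * z $ k) = x $ k) \<and> (\<forall>z\<in>S. \<mu> z \<ge> 0)"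
      by blast
    then show "\<exists>u. (\<forall>z\<in>S. 0 \<le> u (?p z)) \<and> (\<Sum>z\<in>S. u (?p z)) = 1 \<and>
      v = (\<Sum>z\<in>S. u (?p z) * h z) \<and> (\<forall>k. (\<Sum>z\<in>S. u (?p z) * z $ k) = x $ k)"
      \<comment> \<open>Weights on the graph are functions of pairs; composing with
        \<open>fst\<close> transports weights from \<open>S\<close>, and composing with
        \<open>?p\<close> transports them back.\<close>
      by (intro exI[of _ "\<mu> \<circ> fst"]) simp
  next
    assume "\<exists>u. (\<forall>z\<in>S. 0 \<le> u (?p z)) \<and> (\<Sum>z\<in>S. u (?p z)) = 1 \<and>
      v = (\<Sum>z\<in>S. u (?p z) * h z) \<and> (\<forall>k. (\<Sum>z\<in>S. u (?p z) * z $ k) = x $ k)"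
    then obtain u where "(\<forall>z\<in>S. 0 \<le> u (?p z)) \<and> (\<Sum>z\<in>S. u (?p z)) = 1 \<and>
      v = (\<Sum>z\<in>S. u (?p z) * h z) \<and> (\<forall>k. (\<Sum>z\<in>S. u (?p z) * z $ k) = x $ k)" ..
    then show ?R
      by (intro exI[of _ "u \<circ> ?p"]) simp
  qed
  finally show ?thesis .
qed

text \<open>\<open>GREATEST\<close> carries information only once a greatest value is known to
  exist. This lemma supplies optimal weights, with the coordinatewise constraints merged into one
  vector equation.\<close>

lemma inner_approx_attained:
  assumes "finite S" and "x \<in> convex hull S"
  obtains \<mu> where "inner_approx h S x = (\<Sum>z\<in>S. \<mu> z * h z)" "(\<Sum>z\<in>S. \<mu> z) = 1"
    "(\<Sum>z\<in>S. \<mu> z *\<^sub>R z) = x" "\<forall>z\<in>S. \<mu> z \<ge> 0"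
proof -
  let ?H = "convex hull ((\<lambda>z. (z, h z)) ` S)"
  let ?V = "{v. (x, v) \<in> ?H}"
  \<comment> \<open>Compactness passes to the slice: cut the compact hull with the closed vertical
    line over \<open>x\<close>, then project continuously.\<close>
  have V: "?V = snd ` (?H \<inter> ({x} \<times> UNIV))"
    by force
  have "compact (?H \<inter> ({x} \<times> UNIV))"
    using assms(1)
    by (intro compact_Int_closed finite_imp_compact_convex_hull closed_Times) auto
  then have "compact ?V"
    unfolding V by (intro compact_continuous_image continuous_intros)
  \<comment> \<open>Any weights representing \<open>x\<close> are admissible, so the slice is
    nonempty.\<close>
  moreover obtain u where "\<forall>z\<in>S. 0 \<le> u z" "sum u S = 1" "(\<Sum>z\<in>S. u z *\<^sub>R z) = x"
    using assms by (auto simp: convex_hull_finite)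
  then have "(x, \<Sum>z\<in>S. u z * h z) \<in> ?H"
    unfolding slice_convex_hull_graph[OF assms(1)]
    by (intro exI[of _ u]) auto
  then have "?V \<noteq> {}"
    by blast
  ultimately obtain m where m: "(x, m) \<in> ?H" "\<forall>v. (x, v) \<in> ?H \<longrightarrow> v \<le> m"
    using compact_attains_sup[of ?V] by auto
  have "inner_approx h S x = (GREATEST v. (x, v) \<in> ?H)"
    by (simp add: inner_approx_def slice_convex_hull_graph[OF assms(1)])
  also have "\<dots> = m"
    using m by (intro Greatest_equality) auto
  finally have "inner_approx h S x = m" .
  moreover obtain \<mu> where "m = (\<Sum>z\<in>S. \<mu> z * h z)" "(\<Sum>z\<in>S. \<mu> z) = 1"
    "\<forall>k. (\<Sum>z\<in>S. \<mu> z * z $ k) = x $ k" "\<forall>z\<in>S. \<mu> z \<ge> 0"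
    using m(1) unfolding slice_convex_hull_graph[OF assms(1)] by blast
  ultimately show thesis
    by (intro that[of \<mu>]) (simp_all add: vec_eq_iff)
qed

lemma inner_approx_le_concave:
  assumes "finite S" "S \<subseteq> D" "x \<in> convex hull S" "concave_on D h"
  shows "inner_approx h S x \<le> h x"
proof -
  obtain \<mu> where \<mu>: "inner_approx h S x = (\<Sum>z\<in>S. \<mu> z * h z)" "(\<Sum>z\<in>S. \<mu> z) = 1"
    "(\<Sum>z\<in>S. \<mu> z *\<^sub>R z) = x" "\<forall>z\<in>S. \<mu> z \<ge> 0"
    by (rule inner_approx_attained[OF assms(1,3)])
  have "S \<noteq> {}"
    using assms(3) by auto
  \<comment> \<open>Jensen's inequality for the convex function \<open>- h\<close>, at the optimal
    weights.\<close>
  then have "- h (\<Sum>z\<in>S. \<mu> z *\<^sub>R z) \<le> (\<Sum>z\<in>S. \<mu> z * - h z)"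
    using assms \<mu> by (intro convex_on_sum[where C = D]) (auto simp: concave_on_def)
  then show ?thesis
    by (simp add: \<mu> sum_negf)
qed

lemma strictly_concave_on_imp_concave_on:
  assumes "strictly_concave_on D h"
  shows "concave_on D h"
  unfolding concave_on_iff
proof (intro conjI ballI allI impI)
  show "convex D"
    using assms by (simp add: strictly_concave_on_def)
  fix x y and u v :: real
  assume xy: "x \<in> D" "y \<in> D" and uv: "0 \<le> u" "0 \<le> v" "u + v = 1"
  \<comment> \<open>Strict concavity speaks only of the last case; in the degenerate ones both sides
    coincide.\<close>
  consider "u = 0" | "v = 0" | "x = y" | "0 < u" "0 < v" "x \<noteq> y"
    using uv by linarith
  then show "u * h x + v * h y \<le> h (u *\<^sub>R x + v *\<^sub>R y)"
  proof cases
    case 3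
    then show ?thesis
      using uv by (simp flip: scaleR_left_distrib distrib_right)
  next
    case 4
    then show ?thesis
      using assms xy uv by (auto simp: strictly_concave_on_def intro: less_imp_le)
  qed (use uv in auto)
qed

theorem theorem1:
  fixes xl xu :: "real ^ 'n"
    and D S :: "(real ^ 'n) set"
    and \<phi> f :: "real ^ 'n \<Rightarrow> real"
    and g :: "nat \<Rightarrow> real ^ 'n \<Rightarrow> real"
    and I :: nat
    and J :: "'n set"
  assumes "\<forall>k. xl $ k \<le> xu $ k"
    and "convex D"
    and "cbox xl xu \<subseteq> D"
    and "strictly_concave_on D \<phi>"
    and "convex_on D f"
    and "\<forall>i\<in>{1..I}. convex_on D (g i)"
    and "\<exists>L. L-lipschitz_on D \<phi>"
    and "\<exists>L. L-lipschitz_on D f"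
    and "\<forall>i\<in>{1..I}. \<exists>L. L-lipschitz_on D (g i)"
    and "finite S"
    and "S \<subseteq> D"
    and "D \<subseteq> convex hull S"
  shows "optimal_value (feasible_set xl xu I g J) (\<lambda>x. f x + inner_approx \<phi> S x)
           \<le> optimal_value (feasible_set xl xu I g J) (\<lambda>x. f x + \<phi> x)"
  unfolding optimal_value_def
\<comment> \<open>Both problems share one feasible set, so each \<open>x\<close> is compared with
  itself; if the set is empty, both values are infinite.\<close>
proof (intro INF_mono bexI)
  fix x assume x: "x \<in> feasible_set xl xu I g J"
  then have "x \<in> convex hull S"
    using assms by (auto simp: feasible_set_def)
  then have "inner_approx \<phi> S x \<le> \<phi> x"
    using assms by (intro inner_approx_le_concave strictly_concave_on_imp_concave_on) auto
  then show "ereal (f x + inner_approx \<phi> S x) \<le> ereal (f x + \<phi> x)"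
    by simp
qed

end
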